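(* Let $(V,m)$ be a discrete measure space and $(b,c)$ a connected graph over $(V,m)$, and let $\mathcal B^{(N)}=D(Q^{(N)})/D(Q^{(D)})$. Then the map $$P:\mathcal B^{(N)}\to\{u_\infty:u\in D(Q^{(N)})\},\qquad [u]\mapsto u_\infty,$$ is well-defined (i.e. $u_\infty=0$ for all $u\in D(Q^{(D)})$), linear, continuous (with the quotient topology from $\langle\cdot,\cdot\rangle_{Q^{(N)}}$ on $\mathcal B^{(N)}$ and locally uniform convergence on the target) and onto. In particular, for every $f\in D(Q^{(N)})$ there exists $w\in D(Q^{(N)})$ with $(\widetilde L+1)w=0$ and $w_\infty=f_\infty$. Furthermore, if $\widehat V$ is compact, then $P$ is injective.
   Context: $V$ is a finite or countably infinite set and $m:V\to(0,\infty)$; $(V,m)$ is a discrete measure space. $C(V)$ is the set of all functions $V\to\mathbb C$, $C_c(V)$ the finitely supported ones, and $\ell^2(V,m)$ carries $\langle u,v\rangle=\sum_x u(x)\overline{v(x)}m(x)$. A graph over $(V,m)$ is a pair $(b,c)$ with $c:V\to[0,\infty)$, $b:V\times V\to[0,\infty)$, $b(x,x)=0$, $b(x,y)=b(y,x)$, $\sum_y b(x,y)<\infty$. A path from $x$ to $y$ is a finite sequence $x=x_1,\dots,x_n=y$ with $b(x_j,x_{j+1})>0$; the graph is connected if any two vertices are joined by a path. Let $\widetilde F=\{u\in C(V):\sum_y|b(x,y)u(y)|<\infty\ \forall x\}$ and $\widetilde L u(x)=\frac{1}{m(x)}\sum_y b(x,y)(u(x)-u(y))+\frac{c(x)}{m(x)}u(x)$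 for $u\in\widetilde F$. $Q^{(N)}$ is the form on $\ell^2(V,m)$ with domain $D(Q^{(N)})=\{u\in\ell^2(V,m):\frac12\sum_{x,y}b(x,y)|u(x)-u(y)|^2+\sum_x c(x)|u(x)|^2<\infty\}$ and $Q^{(N)}(u,v)=\frac12\sum_{x,y}b(x,y)(u(x)-u(y))\overline{(v(x)-v(y))}+\sum_x c(x)u(x)\overline{v(x)}$; it is closed, $D(Q^{(N)})\subseteq\widetilde F$, and $\langle u,v\rangle_{Q^{(N)}}=Q^{(N)}(u,v)+\langle u,v\rangle$. $Q^{(D)}$ is the closure of the restriction of $Q^{(N)}$ to $C_c(V)$. The length of a path $\gamma=(x_1,\dots,x_n)$ is $L(\gamma)=\sum_{j=1}^{n-1}b(x_j,x_{j+1})^{-1/2}$ and $d(x,y)=\inf\{L(\gamma):\gamma\text{ a path from }x\text{ to }y\}$, a metric on $V$. $\widehat V$ is the metric completion of $(V,d)$ and $V_\infty=\widehat V\setminus V$. Every $u\in D(Q^{(N)})$ satisfies $|u(x)-u(y)|\le Q^{(N)}(u,u)^{1/2}d(x,y)$ and extends uniquely to a Lipschitz function $\widehat u$ on $\widehat V$; $u_\infty$ is the restriction of $\widehat u$ to $V_\infty$ (and $u_\infty:=0$ if $V_\infty=\emptyset$). *)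

theory Defs
  imports "HOL-Analysis.Analysis"
begin

definition graph_over :: "('v \<Rightarrow> real) \<Rightarrow> ('v \<Rightarrow> 'v \<Rightarrow> real) \<Rightarrow> ('v \<Rightarrow> real) \<Rightarrow> bool" where
  "graph_over m b c \<longleftrightarrow>
     (\<forall>x. m x > 0) \<and> (\<forall>x. c x \<ge> 0) \<and> (\<forall>x y. b x y \<ge> 0) \<and> (\<forall>x. b x x = 0) \<and>
     (\<forall>x y. b x y = b y x) \<and> (\<forall>x. (\<lambda>y. b x y) summable_on UNIV)"

definition is_path :: "('v \<Rightarrow> 'v \<Rightarrow> real) \<Rightarrow> 'v list \<Rightarrow> 'v \<Rightarrow> 'v \<Rightarrow> bool" where
  "is_path b xs x y \<longleftrightarrow> xs \<noteq> [] \<and> hd xs = x \<and> last xs = y \<and>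
     (\<forall>i. Suc i < length xs \<longrightarrow> b (xs ! i) (xs ! Suc i) > 0)"

definition graph_connected :: "('v \<Rightarrow> 'v \<Rightarrow> real) \<Rightarrow> bool" where
  "graph_connected b \<longleftrightarrow> (\<forall>x y. \<exists>xs. is_path b xs x y)"

definition path_length :: "('v \<Rightarrow> 'v \<Rightarrow> real) \<Rightarrow> 'v list \<Rightarrow> real" where
  "path_length b xs = (\<Sum>i<length xs - 1. 1 / sqrt (b (xs ! i) (xs ! Suc i)))"

definition path_metric :: "('v \<Rightarrow> 'v \<Rightarrow> real) \<Rightarrow> 'v \<Rightarrow> 'v \<Rightarrow> real" where
  "path_metric b x y = Inf {path_length b xs | xs. is_path b xs x y}"

definition in_l2 :: "('v \<Rightarrow> real) \<Rightarrow> ('v \<Rightarrow> complex) \<Rightarrow> bool" where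
  "in_l2 m u \<longleftrightarrow> (\<lambda>x. (cmod (u x))\<^sup>2 * m x) summable_on UNIV"

definition l2_normsq :: "('v \<Rightarrow> real) \<Rightarrow> ('v \<Rightarrow> complex) \<Rightarrow> real" where
  "l2_normsq m u = (\<Sum>\<^sub>\<infinity>x. (cmod (u x))\<^sup>2 * m x)"

definition energy_finite :: "('v \<Rightarrow> 'v \<Rightarrow> real) \<Rightarrow> ('v \<Rightarrow> real) \<Rightarrow> ('v \<Rightarrow> complex) \<Rightarrow> bool" where
  "energy_finite b c u \<longleftrightarrow>
     (\<lambda>(x, y). b x y * (cmod (u x - u y))\<^sup>2) summable_on UNIV \<and>
     (\<lambda>x. c x * (cmod (u x))\<^sup>2) summable_on UNIV"

definition QN :: "('v \<Rightarrow> 'v \<Rightarrow> real) \<Rightarrow> ('v \<Rightarrow> real) \<Rightarrow> ('v \<Rightarrow> complex) \<Rightarrow> real" where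
  "QN b c u = (1/2) * (\<Sum>\<^sub>\<infinity>(x, y). b x y * (cmod (u x - u y))\<^sup>2) + (\<Sum>\<^sub>\<infinity>x. c x * (cmod (u x))\<^sup>2)"

definition DQN :: "('v \<Rightarrow> real) \<Rightarrow> ('v \<Rightarrow> 'v \<Rightarrow> real) \<Rightarrow> ('v \<Rightarrow> real) \<Rightarrow> ('v \<Rightarrow> complex) set" where
  "DQN m b c = {u. in_l2 m u \<and> energy_finite b c u}"

definition QN_norm :: "('v \<Rightarrow> real) \<Rightarrow> ('v \<Rightarrow> 'v \<Rightarrow> real) \<Rightarrow> ('v \<Rightarrow> real) \<Rightarrow> ('v \<Rightarrow> complex) \<Rightarrow> real" where
  "QN_norm m b c u = sqrt (QN b c u + l2_normsq m u)"

definition DQD :: "('v \<Rightarrow> real) \<Rightarrow> ('v \<Rightarrow> 'v \<Rightarrow> real) \<Rightarrow> ('v \<Rightarrow> real) \<Rightarrow> ('v \<Rightarrow> complex) set" where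
  "DQD m b c = {u \<in> DQN m b c. \<exists>\<phi> :: nat \<Rightarrow> 'v \<Rightarrow> complex.
      (\<forall>n. finite {x. \<phi> n x \<noteq> 0} \<and> \<phi> n \<in> DQN m b c) \<and>
      (\<lambda>n. QN_norm m b c (\<lambda>x. u x - \<phi> n x)) \<longlonglongrightarrow> 0}"

definition quot_norm :: "('v \<Rightarrow> real) \<Rightarrow> ('v \<Rightarrow> 'v \<Rightarrow> real) \<Rightarrow> ('v \<Rightarrow> real) \<Rightarrow> ('v \<Rightarrow> complex) \<Rightarrow> real" where
  "quot_norm m b c u = Inf {QN_norm m b c (\<lambda>x. u x - \<phi> x) | \<phi>. \<phi> \<in> DQD m b c}"

definition Ltilde :: "('v \<Rightarrow> real) \<Rightarrow> ('v \<Rightarrow> 'v \<Rightarrow> real) \<Rightarrow> ('v \<Rightarrow> real) \<Rightarrow> ('v \<Rightarrow> complex) \<Rightarrow> 'v \<Rightarrow> complex" where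
  "Ltilde m b c u x = (1 / complex_of_real (m x)) * (\<Sum>\<^sub>\<infinity>y. complex_of_real (b x y) * (u x - u y))
      + complex_of_real (c x / m x) * u x"

definition is_completion :: "('v \<Rightarrow> 'v \<Rightarrow> real) \<Rightarrow> ('v \<Rightarrow> 'x::metric_space) \<Rightarrow> 'x set \<Rightarrow> bool" where
  "is_completion d \<iota> X \<longleftrightarrow> complete X \<and> range \<iota> \<subseteq> X \<and> X \<subseteq> closure (range \<iota>) \<and>
     (\<forall>x y. dist (\<iota> x) (\<iota> y) = d x y)"

definition ext_val :: "('v \<Rightarrow> 'x::metric_space) \<Rightarrow> ('v \<Rightarrow> complex) \<Rightarrow> 'x \<Rightarrow> complex" where
  "ext_val \<iota> u z = Lim (at z within range \<iota>) (\<lambda>p. u (inv \<iota> p))"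

end

(* A function of finite energy is Lipschitz for the path metric, and its value at a vertex x is at most
   its form norm divided by sqrt (m x). Hence evaluation at a boundary point z is bounded on the form
   domain, locally uniformly in z. It kills finitely supported functions, because z is a limit of infinitely
   many vertices, and therefore it kills their closure.

   The solution w is f minus its projection onto that closure: minimality of the form norm under
   finitely supported perturbations is the weak form of (L + 1) w = 0.

   If the completion is compact, a function h vanishing on the boundary satisfies |h| >= e at finitely
   many vertices only (vertices are isolated), so shrinking its modulus by e approximates h by finitely supported functions.

   The form norm is the l2 norm of the weighted differences and values (energy_map), which reduces
   completeness and the parallelogram law to square-summable functions. *)

theory Submission
  imports Defs
begin

section \<open>Square-summable functions\<close>

definition sq_summable :: "('i \<Rightarrow> complex) \<Rightarrow> bool" where
  "sq_summable f \<longleftrightarrow> (\<lambda>i. (cmod (f i))\<^sup>2) summable_on UNIV"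

definition l2norm :: "('i \<Rightarrow> complex) \<Rightarrow> real" where
  "l2norm f = sqrt (\<Sum>\<^sub>\<infinity>i. (cmod (f i))\<^sup>2)"

lemma l2norm_nonneg [simp]: "0 \<le> l2norm f"
  by (simp add: l2norm_def infsum_nonneg)

lemma l2norm_sq: "(l2norm f)\<^sup>2 = (\<Sum>\<^sub>\<infinity>i. (cmod (f i))\<^sup>2)"
  by (simp add: l2norm_def infsum_nonneg)

lemma sum_le_l2norm_sq:
  assumes "sq_summable f" "finite F"
  shows "(\<Sum>i\<in>F. (cmod (f i))\<^sup>2) \<le> (l2norm f)\<^sup>2"
  unfolding l2norm_sq
  by (rule finite_sum_le_infsum) (use assms in \<open>auto simp: sq_summable_def\<close>)

lemma L2_set_le_l2norm:
  assumes "sq_summable f" "finite F"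
  shows "L2_set (\<lambda>i. cmod (f i)) F \<le> l2norm f"
  using sum_le_l2norm_sq[OF assms] unfolding L2_set_def
  by (simp add: real_le_lsqrt sum_nonneg)

lemma norm_le_l2norm:
  assumes "sq_summable f"
  shows "cmod (f i) \<le> l2norm f"
  using L2_set_le_l2norm[OF assms, of "{i}"] by simp

lemma sq_summable_sum_bound:
  assumes "\<And>F. finite F \<Longrightarrow> (\<Sum>i\<in>F. (cmod (f i))\<^sup>2) \<le> M"
  shows "sq_summable f" "(l2norm f)\<^sup>2 \<le> M"
proof -
  show s: "sq_summable f"
    unfolding sq_summable_def
    by (rule nonneg_bdd_above_summable_on) (use assms in \<open>auto simp: bdd_above_def\<close>)
  show "(l2norm f)\<^sup>2 \<le> M"
    unfolding l2norm_sq
    by (rule infsum_le_finite_sums) (use s assms in \<open>auto simp: sq_summable_def\<close>)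
qed

text \<open>Phrased through \<open>L2_set\<close> so that Minkowski's inequality and limits of
  finite sums carry over to \<open>l2norm\<close> directly.\<close>

lemma sq_summable_L2_bound:
  assumes "\<And>F. finite F \<Longrightarrow> L2_set (\<lambda>i. cmod (f i)) F \<le> M"
  shows "sq_summable f" "l2norm f \<le> M"
proof -
  have M: "M \<ge> 0"
    using assms[of "{}"] by simp
  have bound: "(\<Sum>i\<in>F. (cmod (f i))\<^sup>2) \<le> M\<^sup>2" if "finite F" for F
    using power_mono[OF assms[OF that] L2_set_nonneg, of 2]
    by (simp add: L2_set_def sum_nonneg)
  show "sq_summable f"
    by (rule sq_summable_sum_bound(1)[OF bound])
  show "l2norm f \<le> M"
    using sq_summable_sum_bound(2)[of f, OF bound] M by (simp add: power2_le_iff_abs_le)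
qed

lemma sq_summable_dominated:
  assumes "sq_summable f" "\<And>i. cmod (g i) \<le> cmod (f i)"
  shows "sq_summable g"
proof -
  have "(\<Sum>i\<in>F. (cmod (g i))\<^sup>2) \<le> (l2norm f)\<^sup>2" if "finite F" for F
    by (rule order.trans[OF sum_mono sum_le_l2norm_sq[OF assms(1) that]]) (simp add: assms)
  then show ?thesis by (rule sq_summable_sum_bound)
qed

lemma l2norm_triangle:
  assumes "sq_summable f" "sq_summable g"
  shows "sq_summable (\<lambda>i. f i + g i)" "l2norm (\<lambda>i. f i + g i) \<le> l2norm f + l2norm g"
proof -
  have *: "L2_set (\<lambda>i. cmod (f i + g i)) F \<le> l2norm f + l2norm g" if "finite F" for F
  proof -
    have "L2_set (\<lambda>i. cmod (f i + g i)) F \<le> L2_set (\<lambda>i. cmod (f i) + cmod (g i)) F"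
      by (rule L2_set_mono) (auto intro: norm_triangle_ineq)
    also have "\<dots> \<le> L2_set (\<lambda>i. cmod (f i)) F + L2_set (\<lambda>i. cmod (g i)) F"
      by (rule L2_set_triangle_ineq)
    also have "\<dots> \<le> l2norm f + l2norm g"
      by (intro add_mono L2_set_le_l2norm assms that)
    finally show ?thesis .
  qed
  show "sq_summable (\<lambda>i. f i + g i)"
    by (rule sq_summable_L2_bound(1)[OF *])
  show "l2norm (\<lambda>i. f i + g i) \<le> l2norm f + l2norm g"
    by (rule sq_summable_L2_bound(2)[OF *])
qed

lemma l2norm_scale: "l2norm (\<lambda>i. a * f i) = cmod a * l2norm f"
  by (simp add: l2norm_def norm_mult power_mult_distrib infsum_cmult_right' real_sqrt_mult)

lemma sq_summable_scale:
  assumes "sq_summable f" shows "sq_summable (\<lambda>i. a * f i)"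
  using assms by (simp add: sq_summable_def norm_mult power_mult_distrib summable_on_cmult_right)

section \<open>Parallelogram law, limit theorems and orthogonality of minimizers\<close>

lemma l2norm_parallelogram:
  assumes f: "sq_summable f" and g: "sq_summable g"
  shows "(l2norm (\<lambda>i. f i - g i))\<^sup>2
    = 2 * (l2norm f)\<^sup>2 + 2 * (l2norm g)\<^sup>2 - 4 * (l2norm (\<lambda>i. (f i + g i) / 2))\<^sup>2"
proof -
  have "sq_summable (\<lambda>i. (f i + g i) / 2)"
    using sq_summable_scale[OF l2norm_triangle(1)[OF f g], of "1/2"] by simp
  then have hs: "((\<lambda>i. (cmod (f i))\<^sup>2) has_sum (l2norm f)\<^sup>2) UNIV"
    "((\<lambda>i. (cmod (g i))\<^sup>2) has_sum (l2norm g)\<^sup>2) UNIV"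
    "((\<lambda>i. (cmod ((f i + g i) / 2))\<^sup>2) has_sum (l2norm (\<lambda>i. (f i + g i) / 2))\<^sup>2) UNIV"
    using f g by (simp_all add: sq_summable_def l2norm_sq)
  have eq: "2 * (cmod x)\<^sup>2 + 2 * (cmod y)\<^sup>2 + (-4) * (cmod ((x + y) / 2))\<^sup>2 = (cmod (x - y))\<^sup>2"
    for x y
    unfolding cmod_power2 by (simp add: power2_eq_square field_simps)
  have "((\<lambda>i. 2 * (cmod (f i))\<^sup>2 + 2 * (cmod (g i))\<^sup>2 + (-4) * (cmod ((f i + g i) / 2))\<^sup>2) has_sum
      (2 * (l2norm f)\<^sup>2 + 2 * (l2norm g)\<^sup>2 + (-4) * (l2norm (\<lambda>i. (f i + g i) / 2))\<^sup>2)) UNIV"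
    by (intro has_sum_add has_sum_cmult_right hs)
  then have "((\<lambda>i. (cmod (f i - g i))\<^sup>2) has_sum
      (2 * (l2norm f)\<^sup>2 + 2 * (l2norm g)\<^sup>2 + (-4) * (l2norm (\<lambda>i. (f i + g i) / 2))\<^sup>2)) UNIV"
    unfolding eq .
  then show ?thesis
    by (simp add: l2norm_sq infsumI)
qed

text \<open>On a finite index set the norm is continuous under pointwise convergence, so the bound
  survives there; finite sets determine \<open>l2norm\<close>. An eventual bound is asked for
  because a Cauchy condition provides no more than that.\<close>

lemma l2norm_Fatou:
  assumes "\<And>n. sq_summable (f n)" "\<forall>\<^sub>F n in sequentially. l2norm (f n) \<le> M"
    and "\<And>i. (\<lambda>n. f n i) \<longlonglongrightarrow> g i"
  shows "sq_summable g" "l2norm g \<le> M"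
proof -
  have *: "L2_set (\<lambda>i. cmod (g i)) F \<le> M" if "finite F" for F
  proof (rule tendsto_upperbound)
    show "(\<lambda>n. L2_set (\<lambda>i. cmod (f n i)) F) \<longlonglongrightarrow> L2_set (\<lambda>i. cmod (g i)) F"
      unfolding L2_set_def by (intro tendsto_intros assms)
    show "\<forall>\<^sub>F n in sequentially. L2_set (\<lambda>i. cmod (f n i)) F \<le> M"
      using assms(2) by eventually_elim (use L2_set_le_l2norm[OF assms(1) that] in \<open>meson order.trans\<close>)
  qed simp
  show "sq_summable g"
    by (rule sq_summable_L2_bound(1)[OF *])
  show "l2norm g \<le> M"
    by (rule sq_summable_L2_bound(2)[OF *])
qed

lemma l2norm_dominated_convergence:
  assumes f: "sq_summable f" and dom: "\<And>n i. cmod (g n i) \<le> cmod (f i)"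
    and lim: "\<And>i. (\<lambda>n. g n i) \<longlonglongrightarrow> 0"
  shows "(\<lambda>n. l2norm (g n)) \<longlonglongrightarrow> 0"
proof (rule LIMSEQ_I)
  fix r :: real assume r: "r > 0"
  \<comment> \<open>The indices in \<open>F\<close> and those outside contribute at most
    \<open>e\<close> each to the squared norm, and \<open>2 * e\<close> is strictly below the square
    of \<open>r\<close>.\<close>
  define e where "e = r\<^sup>2 / 3"
  have e: "e > 0" using r by (simp add: e_def)
  have "((\<lambda>i. (cmod (f i))\<^sup>2) has_sum (l2norm f)\<^sup>2) UNIV"
    using f by (simp add: sq_summable_def l2norm_sq)
  from has_sum_finite_approximation[OF this e] obtain F where F: "finite F"
    and "dist (\<Sum>i\<in>F. (cmod (f i))\<^sup>2) ((l2norm f)\<^sup>2) \<le> e"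
    by blast
  then have tail: "(l2norm f)\<^sup>2 \<le> (\<Sum>i\<in>F. (cmod (f i))\<^sup>2) + e"
    by (simp add: dist_real_def)
  have "(\<lambda>n. \<Sum>i\<in>F. (cmod (g n i))\<^sup>2) \<longlonglongrightarrow> (\<Sum>i\<in>F. (cmod 0)\<^sup>2)"
    by (intro tendsto_intros lim)
  then have "(\<lambda>n. \<Sum>i\<in>F. (cmod (g n i))\<^sup>2) \<longlonglongrightarrow> 0"
    by simp
  then have "\<forall>\<^sub>F n in sequentially. (\<Sum>i\<in>F. (cmod (g n i))\<^sup>2) < e"
    using e by (rule order_tendstoD(2))
  then obtain N where N: "\<And>n. n \<ge> N \<Longrightarrow> (\<Sum>i\<in>F. (cmod (g n i))\<^sup>2) < e"
    by (auto simp: eventually_sequentially)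
  have "l2norm (g n) < r" if n: "n \<ge> N" for n
  proof -
    have "(l2norm (g n))\<^sup>2 \<le> 2 * e"
    proof (rule sq_summable_sum_bound(2))
      fix G :: "'a set" assume G: "finite G"
      have "(\<Sum>i\<in>G. (cmod (g n i))\<^sup>2) \<le> (\<Sum>i\<in>F \<union> (G - F). (cmod (g n i))\<^sup>2)"
        by (rule sum_mono2) (use F G in auto)
      also have "\<dots> = (\<Sum>i\<in>F. (cmod (g n i))\<^sup>2) + (\<Sum>i\<in>G - F. (cmod (g n i))\<^sup>2)"
        by (rule sum.union_disjoint) (use F G in auto)
      also have "\<dots> \<le> e + (\<Sum>i\<in>G - F. (cmod (f i))\<^sup>2)"
        by (intro add_mono sum_mono less_imp_le[OF N[OF n]] power_mono dom) auto
      also have "(\<Sum>i\<in>G - F. (cmod (f i))\<^sup>2) \<le> e"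
      proof -
        have "(\<Sum>i\<in>F. (cmod (f i))\<^sup>2) + (\<Sum>i\<in>G - F. (cmod (f i))\<^sup>2)
            = (\<Sum>i\<in>F \<union> (G - F). (cmod (f i))\<^sup>2)"
          by (rule sum.union_disjoint[symmetric]) (use F G in auto)
        also have "\<dots> \<le> (l2norm f)\<^sup>2"
          by (rule sum_le_l2norm_sq[OF f]) (use F G in auto)
        finally show ?thesis using tail by linarith
      qed
      finally show "(\<Sum>i\<in>G. (cmod (g n i))\<^sup>2) \<le> 2 * e" by simp
    qed
    also have "\<dots> < r\<^sup>2" using r by (simp add: e_def)
    finally show ?thesis using r by (simp add: power_less_imp_less_base)
  qed
  then show "\<exists>N. \<forall>n\<ge>N. norm (l2norm (g n) - 0) < r" by auto
qed

lemma summable_l2_product: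
  assumes "sq_summable f" "sq_summable g"
  shows "(\<lambda>i. f i * cnj (g i)) summable_on UNIV"
proof (rule abs_summable_summable, rule summable_on_comparison_test)
  show "(\<lambda>i. (cmod (f i))\<^sup>2 + (cmod (g i))\<^sup>2) summable_on UNIV"
    using assms unfolding sq_summable_def by (rule summable_on_add)
  show "norm (f i * cnj (g i)) \<le> (cmod (f i))\<^sup>2 + (cmod (g i))\<^sup>2" for i
  proof -
    have "0 \<le> cmod (f i) * cmod (g i)" by simp
    then show ?thesis
      using sum_squares_bound[of "cmod (f i)" "cmod (g i)"] unfolding norm_mult complex_mod_cnj
      by linarith
  qed
qed simp

text \<open>First variation: if the inner product \<open>A\<close> of \<open>f\<close> and
  \<open>g\<close> were nonzero, a small step from \<open>f\<close> along \<open>g\<close> in the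
  direction \<open>- A\<close> would lower the norm.\<close>

lemma l2norm_minimal_orthogonal:
  assumes f: "sq_summable f" and g: "sq_summable g"
    and min: "\<And>t. l2norm f \<le> l2norm (\<lambda>i. f i + t * g i)"
  shows "((\<lambda>i. f i * cnj (g i)) has_sum 0) UNIV"
proof -
  define A where "A = (\<Sum>\<^sub>\<infinity>i. f i * cnj (g i))"
  have A: "((\<lambda>i. f i * cnj (g i)) has_sum A) UNIV"
    using summable_l2_product[OF f g] by (simp add: A_def)
  \<comment> \<open>With this step size the quadratic term cannot outweigh the linear one, since
    \<open>s\<close> times the squared norm of \<open>g\<close> stays below 1. The summand 1 keeps
    the denominator positive for \<open>g = 0\<close>.\<close>
  define s where "s = 1 / ((l2norm g)\<^sup>2 + 1)"
  define t where "t = - of_real s * A"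
  have E: "(l2norm g)\<^sup>2 + 1 > 0" by (smt (verit) zero_le_power2)
  have s: "s > 0" "s * (l2norm g)\<^sup>2 < 1"
    using E by (simp_all add: s_def)
  have hs: "((\<lambda>i. (cmod (f i))\<^sup>2) has_sum (l2norm f)\<^sup>2) UNIV"
    "((\<lambda>i. (cmod (g i))\<^sup>2) has_sum (l2norm g)\<^sup>2) UNIV"
    using f g by (simp_all add: sq_summable_def l2norm_sq)
  have eq: "(cmod x)\<^sup>2 + 2 * Re (cnj t * (x * cnj y)) + (cmod t)\<^sup>2 * (cmod y)\<^sup>2
      = (cmod (x + t * y))\<^sup>2" for x y
    unfolding cmod_power2 by (simp add: power2_eq_square algebra_simps)
  have "((\<lambda>i. (cmod (f i))\<^sup>2 + 2 * Re (cnj t * (f i * cnj (g i))) + (cmod t)\<^sup>2 * (cmod (g i))\<^sup>2)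
      has_sum ((l2norm f)\<^sup>2 + 2 * Re (cnj t * A) + (cmod t)\<^sup>2 * (l2norm g)\<^sup>2)) UNIV"
    by (intro has_sum_add has_sum_cmult_right has_sum_Re hs A)
  then have "(l2norm (\<lambda>i. f i + t * g i))\<^sup>2
      = (l2norm f)\<^sup>2 + 2 * Re (cnj t * A) + (cmod t)\<^sup>2 * (l2norm g)\<^sup>2"
    unfolding eq by (simp add: l2norm_sq infsumI)
  moreover have "(l2norm f)\<^sup>2 \<le> (l2norm (\<lambda>i. f i + t * g i))\<^sup>2"
    by (intro power_mono min) simp
  moreover have "Re (cnj t * A) = - s * (cmod A)\<^sup>2" "(cmod t)\<^sup>2 = s\<^sup>2 * (cmod A)\<^sup>2"
    unfolding cmod_power2 by (simp_all add: t_def power2_eq_square algebra_simps)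
  ultimately have "0 \<le> 2 * (- s * (cmod A)\<^sup>2) + s\<^sup>2 * (cmod A)\<^sup>2 * (l2norm g)\<^sup>2"
    by simp
  also have "\<dots> = s * (cmod A)\<^sup>2 * (s * (l2norm g)\<^sup>2 - 2)"
    by (simp add: power2_eq_square algebra_simps)
  finally have "0 \<le> s * (cmod A)\<^sup>2 * (s * (l2norm g)\<^sup>2 - 2)" .
  moreover have "s * (l2norm g)\<^sup>2 - 2 < 0" using s by linarith
  ultimately have "s * (cmod A)\<^sup>2 \<le> 0"
    by (simp add: zero_le_mult_iff)
  then have "A = 0"
    using s by (simp add: mult_le_0_iff)
  then show ?thesis using A by simp
qed

section \<open>The form domain as a space of square-summable functions\<close>

text \<open>Square roots of the weights make the map linear in \<open>u\<close> while the squared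
  moduli are the terms of the form norm. The division of \<open>b x y\<close> by 2 is the factor 1/2
  of \<open>QN\<close>, whose sum meets every edge in both orientations.\<close>

definition energy_map ::
  "('v \<Rightarrow> real) \<Rightarrow> ('v \<Rightarrow> 'v \<Rightarrow> real) \<Rightarrow> ('v \<Rightarrow> real) \<Rightarrow> ('v \<Rightarrow> complex) \<Rightarrow>
    ('v \<times> 'v) + ('v + 'v) \<Rightarrow> complex"
  where
  "energy_map m b c u = case_sum (\<lambda>(x, y). of_real (sqrt (b x y / 2)) * (u x - u y))
     (case_sum (\<lambda>x. of_real (sqrt (c x)) * u x) (\<lambda>x. of_real (sqrt (m x)) * u x))"

lemma energy_map_simps [simp]:
  "energy_map m b c u (Inl (x, y)) = of_real (sqrt (b x y / 2)) * (u x - u y)"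
  "energy_map m b c u (Inr (Inl x)) = of_real (sqrt (c x)) * u x"
  "energy_map m b c u (Inr (Inr x)) = of_real (sqrt (m x)) * u x"
  by (simp_all add: energy_map_def)

lemma energy_index_cases:
  obtains x y where "i = Inl (x, y)" | x where "i = Inr (Inl x)" | x where "i = Inr (Inr x)"
  by (metis obj_sumE prod.exhaust)

lemma energy_map_linear:
  "energy_map m b c (\<lambda>x. \<alpha> * u x + \<beta> * v x)
    = (\<lambda>i. \<alpha> * energy_map m b c u i + \<beta> * energy_map m b c v i)"
proof
  show "energy_map m b c (\<lambda>x. \<alpha> * u x + \<beta> * v x) i
    = \<alpha> * energy_map m b c u i + \<beta> * energy_map m b c v i" for i
    by (cases i rule: energy_index_cases) (simp_all add: algebra_simps)
qed

text \<open>Applied twice, this splits a sum over the index type of \<open>energy_map\<close> into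
  edge, killing and mass terms.\<close>

lemma has_sum_sum_type:
  fixes f :: "'a + 'b \<Rightarrow> real"
  assumes "((\<lambda>x. f (Inl x)) has_sum s) UNIV" "((\<lambda>x. f (Inr x)) has_sum t) UNIV"
  shows "(f has_sum (s + t)) UNIV"
proof -
  have "(f has_sum s) (range Inl)" "(f has_sum t) (range Inr)"
    using assms by (simp_all add: has_sum_reindex o_def)
  from has_sum_Un_disjoint[OF this] show ?thesis
    by (auto simp: UNIV_sum[symmetric])
qed

lemma summable_on_sum_type_iff:
  fixes f :: "'a + 'b \<Rightarrow> real"
  shows "f summable_on UNIV \<longleftrightarrow>
    (\<lambda>x. f (Inl x)) summable_on UNIV \<and> (\<lambda>x. f (Inr x)) summable_on UNIV"
proof
  assume "f summable_on UNIV"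
  then have "f summable_on range Inl" "f summable_on range Inr"
    by (auto intro: summable_on_subset_banach)
  then show "(\<lambda>x. f (Inl x)) summable_on UNIV \<and> (\<lambda>x. f (Inr x)) summable_on UNIV"
    by (simp add: summable_on_reindex o_def)
next
  assume "(\<lambda>x. f (Inl x)) summable_on UNIV \<and> (\<lambda>x. f (Inr x)) summable_on UNIV"
  then show "f summable_on UNIV"
    using has_sum_sum_type[of f] unfolding summable_on_def by blast
qed

text \<open>Finite sets are closed in a T1 space. The point \<open>z\<close> may itself lie in
  \<open>F\<close>, but the filter \<open>at z\<close> ignores it.\<close>

lemma eventually_at_notin_finite:
  fixes z :: "'a::t1_space"
  assumes "finite F"
  shows "\<forall>\<^sub>F p in at z within S. p \<notin> F"
  unfolding eventually_at_topological
  by (rule exI[of _ "- (F - {z})"])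
    (use assms in \<open>auto simp del: Compl_Diff_eq intro!: finite_imp_closed\<close>)

locale weighted_graph =
  fixes m :: "'v \<Rightarrow> real" and b :: "'v \<Rightarrow> 'v \<Rightarrow> real" and c :: "'v \<Rightarrow> real"
  assumes graph: "graph_over m b c"
begin

abbreviation "T \<equiv> energy_map m b c"
abbreviation "D \<equiv> DQN m b c"
abbreviation "N \<equiv> QN_norm m b c"

lemma m_pos: "m x > 0" and c_nonneg: "c x \<ge> 0" and b_nonneg: "b x y \<ge> 0"
  and b_diag: "b x x = 0" and b_sym: "b x y = b y x" and b_summable: "b x summable_on UNIV"
  using graph by (auto simp: graph_over_def)

lemma norm_sq_energy_map:
  "(cmod (T u (Inl xy)))\<^sup>2 = (1/2) * (case xy of (x, y) \<Rightarrow> b x y * (cmod (u x - u y))\<^sup>2)"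
  "(cmod (T u (Inr (Inl x))))\<^sup>2 = c x * (cmod (u x))\<^sup>2"
  "(cmod (T u (Inr (Inr x))))\<^sup>2 = (cmod (u x))\<^sup>2 * m x"
  by (cases xy)
    (simp_all add: norm_mult power_mult_distrib b_nonneg c_nonneg less_imp_le[OF m_pos] mult.commute)

lemma mem_D_iff: "u \<in> D \<longleftrightarrow> sq_summable (T u)"
proof -
  have "(\<lambda>xy. (1/2) * (case xy of (x, y) \<Rightarrow> b x y * (cmod (u x - u y))\<^sup>2)) summable_on UNIV
      \<longleftrightarrow> (\<lambda>(x, y). b x y * (cmod (u x - u y))\<^sup>2) summable_on UNIV"
    by (rule summable_on_cmult_right') simp
  then show ?thesis
    unfolding sq_summable_def summable_on_sum_type_iff norm_sq_energy_map
    by (auto simp: DQN_def energy_finite_def in_l2_def)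
qed

lemma N_eq_l2norm:
  assumes "u \<in> D"
  shows "N u = l2norm (T u)"
proof -
  have hs: "((\<lambda>(x, y). b x y * (cmod (u x - u y))\<^sup>2)
      has_sum (\<Sum>\<^sub>\<infinity>(x, y). b x y * (cmod (u x - u y))\<^sup>2)) UNIV"
    "((\<lambda>x. c x * (cmod (u x))\<^sup>2) has_sum (\<Sum>\<^sub>\<infinity>x. c x * (cmod (u x))\<^sup>2)) UNIV"
    "((\<lambda>x. (cmod (u x))\<^sup>2 * m x) has_sum (\<Sum>\<^sub>\<infinity>x. (cmod (u x))\<^sup>2 * m x)) UNIV"
    using assms by (simp_all add: DQN_def energy_finite_def in_l2_def)
  have "((\<lambda>i. (cmod (T u i))\<^sup>2) has_sum
      (1/2 * (\<Sum>\<^sub>\<infinity>(x, y). b x y * (cmod (u x - u y))\<^sup>2) +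
        ((\<Sum>\<^sub>\<infinity>x. c x * (cmod (u x))\<^sup>2) + (\<Sum>\<^sub>\<infinity>x. (cmod (u x))\<^sup>2 * m x)))) UNIV"
    by (intro has_sum_sum_type; unfold norm_sq_energy_map; intro has_sum_cmult_right hs)
  then show ?thesis
    by (simp add: l2norm_def infsumI QN_norm_def QN_def l2_normsq_def add.assoc)
qed

lemma D_linear:
  assumes "u \<in> D" "v \<in> D"
  shows "(\<lambda>x. \<alpha> * u x + \<beta> * v x) \<in> D"
    and "N (\<lambda>x. \<alpha> * u x + \<beta> * v x) \<le> cmod \<alpha> * N u + cmod \<beta> * N v"
proof -
  have s: "sq_summable (\<lambda>i. \<alpha> * T u i)" "sq_summable (\<lambda>i. \<beta> * T v i)"
    using assms by (simp_all add: mem_D_iff sq_summable_scale)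
  show *: "(\<lambda>x. \<alpha> * u x + \<beta> * v x) \<in> D"
    using l2norm_triangle(1)[OF s] by (simp add: mem_D_iff energy_map_linear)
  show "N (\<lambda>x. \<alpha> * u x + \<beta> * v x) \<le> cmod \<alpha> * N u + cmod \<beta> * N v"
    using l2norm_triangle(2)[OF s] * assms
    by (simp add: N_eq_l2norm energy_map_linear l2norm_scale)
qed

lemma D_add:
  assumes "u \<in> D" "v \<in> D"
  shows "(\<lambda>x. u x + v x) \<in> D" "N (\<lambda>x. u x + v x) \<le> N u + N v"
  using D_linear[OF assms, of 1 1] by simp_all

lemma D_diff:
  assumes "u \<in> D" "v \<in> D"
  shows "(\<lambda>x. u x - v x) \<in> D" "N (\<lambda>x. u x - v x) \<le> N u + N v"
  using D_linear[OF assms, of 1 "-1"] by simp_all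

lemma energy_map_diff: "T (\<lambda>x. u x - v x) = (\<lambda>i. T u i - T v i)"
  using energy_map_linear[of m b c 1 u "-1" v] by simp

lemma N_nonneg: "u \<in> D \<Longrightarrow> 0 \<le> N u"
  by (simp add: N_eq_l2norm)

lemma N_zero [simp]: "N (\<lambda>x. 0) = 0"
  by (simp add: QN_norm_def QN_def l2_normsq_def case_prod_unfold)

text \<open>Only edges at \<open>x\<close> carry energy, so summability of the row
  \<open>b x\<close> suffices. These indicators are the test functions that yield the equation
  vertex by vertex.\<close>

lemma indicator_in_D: "(\<lambda>y. if y = x then 1 else 0) \<in> D"
proof -
  let ?e = "\<lambda>y. if y = x then 1 else (0::complex)"
  \<comment> \<open>The diagonal pair is removed so that the edges leaving \<open>x\<close> and
    those entering \<open>x\<close> form disjoint index sets.\<close>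
  have "(\<lambda>y. b x y) summable_on UNIV - {x}" "(\<lambda>y. b y x) summable_on UNIV - {x}"
    using b_summable[of x] unfolding b_sym[of _ x]
    by (auto intro: summable_on_subset_banach)
  then have "(\<lambda>(p, q). b p q) summable_on Pair x ` (UNIV - {x})"
    "(\<lambda>(p, q). b p q) summable_on (\<lambda>y. (y, x)) ` (UNIV - {x})"
    by (subst summable_on_reindex; auto simp: o_def inj_on_def)+
  then have "(\<lambda>(p, q). b p q) summable_on
      Pair x ` (UNIV - {x}) \<union> (\<lambda>y. (y, x)) ` (UNIV - {x})"
    by (rule summable_on_Un_disjoint) auto
  then have "(\<lambda>(p, q). b p q * (cmod (?e p - ?e q))\<^sup>2) summable_on UNIV"
    by (rule summable_on_cong_neutral[THEN iffD1, rotated -1]) (auto split: if_splits)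
  moreover have "(\<lambda>p. c p * (cmod (?e p))\<^sup>2) summable_on UNIV"
    "(\<lambda>p. (cmod (?e p))\<^sup>2 * m p) summable_on UNIV"
    by (rule finite_nonzero_values_imp_summable_on, rule finite_subset[of _ "{x}"]; auto)+
  ultimately show ?thesis
    by (simp add: DQN_def energy_finite_def in_l2_def)
qed

section \<open>Pointwise, edge and path estimates on the form domain\<close>

lemma point_bound:
  assumes "u \<in> D"
  shows "cmod (u x) \<le> N u / sqrt (m x)"
proof -
  have "cmod (T u (Inr (Inr x))) \<le> N u"
    using norm_le_l2norm[of "T u"] assms
    by (simp add: N_eq_l2norm mem_D_iff del: energy_map_simps)
  then show ?thesis
    using m_pos[of x] by (simp add: norm_mult field_simps)
qed

text \<open>Both orientations of the edge occur among the terms of the norm and together cancel the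
  factor 1/2, which gives the Lipschitz constant \<open>N u\<close> exactly for the edge length used
  in \<open>path_length\<close>.\<close>

lemma edge_bound:
  assumes "u \<in> D" "b x y > 0"
  shows "cmod (u x - u y) \<le> N u * (1 / sqrt (b x y))"
proof -
  have "x \<noteq> y" using assms b_diag[of x] by auto
  then have "(\<Sum>i\<in>{Inl (x, y), Inl (y, x)}. (cmod (T u i))\<^sup>2) = b x y * (cmod (u x - u y))\<^sup>2"
    by (simp add: norm_sq_energy_map b_sym[of y x] norm_minus_commute[of "u y"] del: energy_map_simps)
  then have "b x y * (cmod (u x - u y))\<^sup>2 \<le> (N u)\<^sup>2"
    using sum_le_l2norm_sq[of "T u" "{Inl (x, y), Inl (y, x)}"] assms
    by (simp add: N_eq_l2norm mem_D_iff del: energy_map_simps)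
  then have "(sqrt (b x y) * cmod (u x - u y))\<^sup>2 \<le> (N u)\<^sup>2"
    using assms(2) by (simp add: power_mult_distrib)
  then have "sqrt (b x y) * cmod (u x - u y) \<le> N u"
    using N_nonneg[OF assms(1)] by (rule power2_le_imp_le)
  then show ?thesis using assms(2) by (simp add: field_simps)
qed

lemma is_path_Cons_Cons:
  "is_path b (p # q # xs) x y \<longleftrightarrow> p = x \<and> b p q > 0 \<and> is_path b (q # xs) q y"
  by (auto simp: is_path_def less_Suc_eq_0_disj nth_Cons split: nat.splits)

lemma path_length_Cons_Cons:
  "path_length b (p # q # xs) = 1 / sqrt (b p q) + path_length b (q # xs)"
  by (simp add: path_length_def sum.lessThan_Suc_shift del: sum.lessThan_Suc)

lemma path_length_nonneg: "path_length b xs \<ge> 0"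
  by (auto simp: path_length_def b_nonneg intro!: sum_nonneg)

lemma path_bound:
  assumes "u \<in> D" "is_path b xs x y"
  shows "cmod (u x - u y) \<le> N u * path_length b xs"
  using assms(2)
proof (induction xs arbitrary: x rule: induct_list012)
  case (2 z)
  then show ?case using N_nonneg[OF assms(1)] by (auto simp: is_path_def path_length_def)
next
  case (3 p q xs)
  then have *: "p = x" "b x q > 0" "is_path b (q # xs) q y"
    by (auto simp: is_path_Cons_Cons)
  have "cmod (u x - u y) \<le> cmod (u x - u q) + cmod (u q - u y)"
    using norm_triangle_ineq[of "u x - u q" "u q - u y"] by simp
  also have "\<dots> \<le> N u * (1 / sqrt (b x q)) + N u * path_length b (q # xs)"
    by (intro add_mono edge_bound[OF assms(1) *(2)] 3(2)[OF *(3)])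
  finally show ?case
    using * by (simp add: path_length_Cons_Cons algebra_simps)
qed (simp add: is_path_def)

text \<open>The first edge of a path leaving \<open>x\<close> weighs at most the weighted degree of
  \<open>x\<close>, so this edge alone has the stated length. The positivity claim guarantees that
  the lower bound is itself positive.\<close>

lemma path_length_ge_degree:
  assumes "is_path b xs x y" "x \<noteq> y"
  shows "1 / sqrt (\<Sum>\<^sub>\<infinity>z. b x z) \<le> path_length b xs" "0 < (\<Sum>\<^sub>\<infinity>z. b x z)"
proof -
  obtain q ys where xs: "xs = x # q # ys"
    using assms by (cases xs rule: remdups_adj.cases) (auto simp: is_path_def)
  then have q: "b x q > 0" using assms by (simp add: is_path_Cons_Cons)
  have "sum (b x) {q} \<le> (\<Sum>\<^sub>\<infinity>z. b x z)"
    by (rule finite_sum_le_infsum) (auto simp: b_nonneg b_summable)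
  then have le: "b x q \<le> (\<Sum>\<^sub>\<infinity>z. b x z)" by simp
  with q show "0 < (\<Sum>\<^sub>\<infinity>z. b x z)" by simp
  have "1 / sqrt (\<Sum>\<^sub>\<infinity>z. b x z) \<le> 1 / sqrt (b x q)"
    using q le by (intro divide_left_mono) auto
  also have "\<dots> \<le> path_length b xs"
    using path_length_nonneg by (simp add: xs path_length_Cons_Cons)
  finally show "1 / sqrt (\<Sum>\<^sub>\<infinity>z. b x z) \<le> path_length b xs" .
qed

section \<open>Completeness, projection and the equation of a minimizer\<close>

lemma D_complete:
  assumes u: "\<And>n. u n \<in> D"
    and cauchy: "\<And>e. e > 0 \<Longrightarrow> \<exists>M. \<forall>p\<ge>M. \<forall>q\<ge>M. N (\<lambda>x. u p x - u q x) \<le> e"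
  obtains w where "w \<in> D" "(\<lambda>n. N (\<lambda>x. u n x - w x)) \<longlonglongrightarrow> 0"
proof -
  have "Cauchy (\<lambda>n. u n x)" for x
  proof (rule CauchyI)
    fix e :: real assume e: "e > 0"
    then have e': "e / 2 * sqrt (m x) > 0" using m_pos[of x] by simp
    from cauchy[OF this] obtain M where
      M: "\<And>p q. p \<ge> M \<Longrightarrow> q \<ge> M \<Longrightarrow> N (\<lambda>x. u p x - u q x) \<le> e / 2 * sqrt (m x)" by blast
    have "norm (u p x - u q x) < e" if "p \<ge> M" "q \<ge> M" for p q
    proof -
      have "norm (u p x - u q x) \<le> N (\<lambda>x. u p x - u q x) / sqrt (m x)"
        using point_bound[OF D_diff(1)[OF u u], of p x q] .
      also have "\<dots> \<le> e / 2"
        using M[OF that] m_pos[of x] by (simp add: field_simps)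
      finally show ?thesis using e by simp
    qed
    then show "\<exists>M. \<forall>p\<ge>M. \<forall>q\<ge>M. norm (u p x - u q x) < e" by blast
  qed
  then have "\<forall>x. \<exists>l. (\<lambda>n. u n x) \<longlonglongrightarrow> l"
    by (simp add: Cauchy_convergent_iff convergent_def)
  then obtain w where w: "\<And>x. (\<lambda>n. u n x) \<longlonglongrightarrow> w x" by metis
  have lim: "(\<lambda>q. T (\<lambda>x. u p x - u q x) i) \<longlonglongrightarrow> T (\<lambda>x. u p x - w x) i" for p i
    by (cases i rule: energy_index_cases) (auto intro!: tendsto_intros w)
  have close: "(\<lambda>x. u p x - w x) \<in> D \<and> N (\<lambda>x. u p x - w x) \<le> e"
    if M: "\<And>p q. p \<ge> M \<Longrightarrow> q \<ge> M \<Longrightarrow> N (\<lambda>x. u p x - u q x) \<le> e" and p: "p \<ge> M" for p M e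
  proof -
    have s: "\<And>q. sq_summable (T (\<lambda>x. u p x - u q x))"
      using D_diff(1)[OF u u] by (simp add: mem_D_iff)
    \<comment> \<open>For fixed \<open>p\<close> the Cauchy bound holds for all large
      \<open>q\<close>; letting \<open>q\<close> tend to infinity turns it into a bound on the
      distance from \<open>u p\<close> to the pointwise limit \<open>w\<close>.\<close>
    have "\<forall>\<^sub>F q in sequentially. l2norm (T (\<lambda>x. u p x - u q x)) \<le> e"
      using M[OF p] D_diff(1)[OF u u] by (auto simp: eventually_sequentially N_eq_l2norm)
    from l2norm_Fatou[OF s this lim] show ?thesis
      by (simp add: mem_D_iff N_eq_l2norm)
  qed
  obtain M where "\<And>p q. p \<ge> M \<Longrightarrow> q \<ge> M \<Longrightarrow> N (\<lambda>x. u p x - u q x) \<le> 1"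
    using cauchy[of 1] by auto
  from close[OF this order.refl] have "(\<lambda>x. u M x - w x) \<in> D" by blast
  \<comment> \<open>\<open>w\<close> is \<open>u M\<close> minus the difference
    \<open>u M - w\<close>, both in the domain.\<close>
  from D_diff(1)[OF u[of M] this] have wD: "w \<in> D" by simp
  have "(\<lambda>n. N (\<lambda>x. u n x - w x)) \<longlonglongrightarrow> 0"
  proof (rule LIMSEQ_I)
    fix r :: real assume "r > 0"
    then obtain M where "\<And>p q. p \<ge> M \<Longrightarrow> q \<ge> M \<Longrightarrow> N (\<lambda>x. u p x - u q x) \<le> r / 2"
      using cauchy[of "r / 2"] by auto
    from close[OF this] show "\<exists>M. \<forall>p\<ge>M. norm (N (\<lambda>x. u p x - w x) - 0) < r"
      using N_nonneg \<open>r > 0\<close> by (intro exI[of _ M]) (force simp: abs_if)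
  qed
  with wD show ?thesis by (rule that)
qed

text \<open>The Hilbert space projection argument: a minimizing sequence of
  \<open>f - \<phi>\<close> over finitely supported \<phi> is Cauchy by the parallelogram law, and
  its limit \<open>w\<close> differs from \<open>f\<close> by a limit of finitely supported
  functions.\<close>

lemma DQD_projection:
  assumes f: "f \<in> D"
  obtains w where "w \<in> D" "(\<lambda>x. f x - w x) \<in> DQD m b c"
    "\<And>\<psi>. finite {x. \<psi> x \<noteq> 0} \<Longrightarrow> \<psi> \<in> D \<Longrightarrow> N w \<le> N (\<lambda>x. w x + \<psi> x)"
proof -
  define C where "C = {\<phi> \<in> D. finite {x. \<phi> x \<noteq> 0}}"
  define S where "S = (\<lambda>\<phi>. N (\<lambda>x. f x - \<phi> x)) ` C"
  define \<delta> where "\<delta> = Inf S"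
  have CD: "\<phi> \<in> D" if "\<phi> \<in> C" for \<phi> using that by (simp add: C_def)
  have C_linear: "(\<lambda>x. \<alpha> * u x + \<beta> * v x) \<in> C" if "u \<in> C" "v \<in> C" for u v \<alpha> \<beta>
  proof -
    have "finite {x. \<alpha> * u x + \<beta> * v x \<noteq> 0}"
      by (rule finite_subset[of _ "{x. u x \<noteq> 0} \<union> {x. v x \<noteq> 0}"]) (use that in \<open>auto simp: C_def\<close>)
    then show ?thesis using that D_linear(1) by (simp add: C_def)
  qed
  have zero: "(\<lambda>x. 0) \<in> C"
    using D_diff(1)[OF f f] by (simp add: C_def)
  have "S \<noteq> {}" using zero by (auto simp: S_def)
  have "bdd_below S"
    unfolding S_def by (rule bdd_belowI2[of _ 0]) (use N_nonneg D_diff(1) f CD in auto)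
  then have \<delta>_le: "\<delta> \<le> N (\<lambda>x. f x - \<phi> x)" if "\<phi> \<in> C" for \<phi>
    unfolding \<delta>_def S_def using that by (intro cInf_lower) auto
  have \<delta>0: "\<delta> \<ge> 0"
    unfolding \<delta>_def using \<open>S \<noteq> {}\<close> N_nonneg D_diff(1) f CD
    by (intro cInf_greatest) (auto simp: S_def)
  have "\<exists>\<phi>\<in>C. N (\<lambda>x. f x - \<phi> x) < \<delta> + 1 / real (Suc n)" for n
  proof -
    have "\<exists>s\<in>S. s < \<delta> + 1 / real (Suc n)"
      by (rule cInf_lessD[OF \<open>S \<noteq> {}\<close>]) (simp add: \<delta>_def)
    then show ?thesis by (auto simp: S_def)
  qed
  then obtain \<phi> where \<phi>: "\<And>n. \<phi> n \<in> C"
    and \<phi>_le: "\<And>n. N (\<lambda>x. f x - \<phi> n x) < \<delta> + 1 / real (Suc n)" by metis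
  define u where "u n = (\<lambda>x. f x - \<phi> n x)" for n
  have uD: "u n \<in> D" for n unfolding u_def by (rule D_diff(1)[OF f CD[OF \<phi>]])
  have lim: "(\<lambda>n. \<delta> + 1 / real (Suc n)) \<longlonglongrightarrow> \<delta>"
    using tendsto_add[OF tendsto_const[of \<delta>] LIMSEQ_inverse_real_of_nat]
    by (simp add: inverse_eq_divide)
  \<comment> \<open>The midpoint of two competitors is again \<open>f\<close> minus a finitely
    supported function, so its norm is at least \<delta>.\<close>
  have par: "(N (\<lambda>x. u p x - u q x))\<^sup>2 \<le> 2 * (N (u p))\<^sup>2 + 2 * (N (u q))\<^sup>2 - 4 * \<delta>\<^sup>2" for p q
  proof -
    have eq: "(\<lambda>x. (1/2) * u p x + (1/2) * u q x)
        = (\<lambda>x. f x - ((1/2) * \<phi> p x + (1/2) * \<phi> q x))"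
      by (auto simp: u_def field_simps)
    have "\<delta> \<le> N (\<lambda>x. (1/2) * u p x + (1/2) * u q x)"
      unfolding eq by (rule \<delta>_le[OF C_linear[OF \<phi> \<phi>]])
    also have "\<dots> = l2norm (\<lambda>i. (T (u p) i + T (u q) i) / 2)"
      using D_linear(1)[OF uD uD, of "1/2" p "1/2" q]
      by (simp add: N_eq_l2norm energy_map_linear[of _ _ _ "1/2" _ "1/2", simplified] add_divide_distrib)
    finally have "\<delta>\<^sup>2 \<le> (l2norm (\<lambda>i. (T (u p) i + T (u q) i) / 2))\<^sup>2"
      using \<delta>0 by (intro power_mono)
    then show ?thesis
      using l2norm_parallelogram[of "T (u p)" "T (u q)"] uD D_diff(1)[OF uD uD, of p q]
      by (simp add: N_eq_l2norm mem_D_iff energy_map_diff)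
  qed
  have "\<exists>M. \<forall>p\<ge>M. \<forall>q\<ge>M. N (\<lambda>x. u p x - u q x) \<le> e" if e: "e > 0" for e
  proof -
    have "(\<lambda>n. (\<delta> + 1 / real (Suc n))\<^sup>2) \<longlonglongrightarrow> \<delta>\<^sup>2"
      by (intro tendsto_intros lim)
    \<comment> \<open>In \<open>par\<close> the two excesses of \<open>e\<^sup>2 / 4\<close> are
      each doubled, which gives \<open>e\<^sup>2\<close> in total.\<close>
    moreover have "\<delta>\<^sup>2 < \<delta>\<^sup>2 + e\<^sup>2 / 4" using e by simp
    ultimately have "\<forall>\<^sub>F n in sequentially. (\<delta> + 1 / real (Suc n))\<^sup>2 < \<delta>\<^sup>2 + e\<^sup>2 / 4"
      by (rule order_tendstoD(2))
    then obtain M where M: "\<And>n. n \<ge> M \<Longrightarrow> (\<delta> + 1 / real (Suc n))\<^sup>2 < \<delta>\<^sup>2 + e\<^sup>2 / 4"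
      by (auto simp: eventually_sequentially)
    have M': "(N (u n))\<^sup>2 \<le> \<delta>\<^sup>2 + e\<^sup>2 / 4" if "n \<ge> M" for n
    proof -
      have "(N (u n))\<^sup>2 \<le> (\<delta> + 1 / real (Suc n))\<^sup>2"
        by (rule power_mono[OF less_imp_le N_nonneg[OF uD]]) (use \<phi>_le[of n] in \<open>simp add: u_def\<close>)
      with M[OF that] show ?thesis by simp
    qed
    have "N (\<lambda>x. u p x - u q x) \<le> e" if "p \<ge> M" "q \<ge> M" for p q
    proof (rule power2_le_imp_le)
      show "(N (\<lambda>x. u p x - u q x))\<^sup>2 \<le> e\<^sup>2"
        using par[of p q] M'[OF that(1)] M'[OF that(2)] by linarith
    qed (use e in simp)
    then show ?thesis by blast
  qed
  from D_complete[of u, OF uD this] obtain w where w: "w \<in> D"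
    and uw: "(\<lambda>n. N (\<lambda>x. u n x - w x)) \<longlonglongrightarrow> 0" by blast
  have "(\<lambda>x. f x - w x) \<in> DQD m b c"
    unfolding DQD_def
  proof (intro CollectI conjI exI[of _ \<phi>] allI)
    show "(\<lambda>x. f x - w x) \<in> D" by (rule D_diff(1)[OF f w])
    show "(\<lambda>n. N (\<lambda>x. f x - w x - \<phi> n x)) \<longlonglongrightarrow> 0"
      using uw by (simp add: u_def algebra_simps)
  qed (use \<phi> in \<open>auto simp: C_def\<close>)
  moreover have "N w \<le> N (\<lambda>x. w x + \<psi> x)" if \<psi>: "finite {x. \<psi> x \<noteq> 0}" "\<psi> \<in> D" for \<psi>
  proof -
    \<comment> \<open>Write \<open>w\<close> as \<open>u n - (u n - w)\<close>; the first norm tends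
      to \<delta> and the second to 0.\<close>
    have "N w \<le> \<delta>"
    proof (rule tendsto_lowerbound)
      show "(\<lambda>n. N (\<lambda>x. u n x - w x) + (\<delta> + 1 / real (Suc n))) \<longlonglongrightarrow> \<delta>"
        using tendsto_add[OF uw lim] by simp
      have "N w \<le> N (\<lambda>x. u n x - w x) + (\<delta> + 1 / real (Suc n))" for n
        using D_diff(2)[OF uD D_diff(1)[OF uD w], of n n] \<phi>_le[of n] by (simp add: u_def)
      then show "\<forall>\<^sub>F n in sequentially. N w \<le> N (\<lambda>x. u n x - w x) + (\<delta> + 1 / real (Suc n))"
        by simp
    qed simp
    \<comment> \<open>Here \<open>\<phi> n - \<psi>\<close> is an admissible approximation of
      \<open>f\<close>, with remainder \<open>u n + \<psi>\<close>, which is close to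
      \<open>w + \<psi>\<close>.\<close>
    also have "\<delta> \<le> N (\<lambda>x. w x + \<psi> x)"
    proof (rule tendsto_lowerbound)
      show "(\<lambda>n. N (\<lambda>x. u n x - w x) + N (\<lambda>x. w x + \<psi> x)) \<longlonglongrightarrow> N (\<lambda>x. w x + \<psi> x)"
        using tendsto_add[OF uw tendsto_const] by simp
      have "\<delta> \<le> N (\<lambda>x. u n x - w x) + N (\<lambda>x. w x + \<psi> x)" for n
      proof -
        have "\<psi> \<in> C" using \<psi> by (simp add: C_def)
        then have "\<delta> \<le> N (\<lambda>x. f x - (1 * \<phi> n x + (-1) * \<psi> x))"
          by (intro \<delta>_le C_linear \<phi>)
        also have "(\<lambda>x. f x - (1 * \<phi> n x + (-1) * \<psi> x)) = (\<lambda>x. (u n x - w x) + (w x + \<psi> x))"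
          by (auto simp: u_def)
        also have "N \<dots> \<le> N (\<lambda>x. u n x - w x) + N (\<lambda>x. w x + \<psi> x)"
          by (intro D_add(2) D_diff(1) D_add(1) uD w \<psi>)
        finally show ?thesis .
      qed
      then show "\<forall>\<^sub>F n in sequentially. \<delta> \<le> N (\<lambda>x. u n x - w x) + N (\<lambda>x. w x + \<psi> x)"
        by simp
    qed simp
    finally show ?thesis .
  qed
  ultimately show ?thesis using w by (intro that)
qed

text \<open>Minimality along multiples of the indicator \<open>e\<close> of \<open>x\<close> makes
  \<open>T w\<close> orthogonal to \<open>T e\<close>. Written out, this orthogonality is the
  equation at \<open>x\<close> multiplied by \<open>m x\<close>.\<close>

lemma Ltilde_minimizer:
  assumes w: "w \<in> D"
    and min: "\<And>\<psi>. finite {x. \<psi> x \<noteq> 0} \<Longrightarrow> \<psi> \<in> D \<Longrightarrow> N w \<le> N (\<lambda>x. w x + \<psi> x)"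
  shows "Ltilde m b c w x + w x = 0"
proof -
  define e where "e y = (if y = x then 1 else (0::complex))" for y
  have e: "e \<in> D"
    using indicator_in_D[of x] by (simp add: e_def[abs_def])
  define G where "G i = T w i * cnj (T e i)" for i
  have "l2norm (T w) \<le> l2norm (\<lambda>i. T w i + t * T e i)" for t
  proof -
    have te: "(\<lambda>y. t * e y) \<in> D" using D_linear(1)[OF e e, of t 0] by simp
    have "finite {y. t * e y \<noteq> 0}"
      by (rule finite_subset[of _ "{x}"]) (auto simp: e_def)
    from min[OF this te] have "N w \<le> N (\<lambda>y. 1 * w y + t * e y)" by simp
    also have "\<dots> = l2norm (\<lambda>i. T w i + t * T e i)"
      using D_linear(1)[OF w e, of 1 t] by (simp add: N_eq_l2norm energy_map_linear[of _ _ _ 1, simplified])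
    finally show ?thesis using w by (simp add: N_eq_l2norm)
  qed
  then have G0: "(G has_sum 0) UNIV"
    unfolding G_def using w e by (intro l2norm_minimal_orthogonal) (auto simp: mem_D_iff)
  define h where "h y = complex_of_real (b x y) * (w x - w y)" for y
  have sq: "complex_of_real (sqrt r) * complex_of_real (sqrt r) = complex_of_real r" if "r \<ge> 0" for r
    using that by (simp flip: of_real_mult)
  have G1: "G (Inl (x, y)) = h y / 2" for y
    using sq[of "b x y / 2"] b_nonneg[of x y]
    by (cases "y = x") (auto simp: G_def e_def h_def mult_ac)
  have G2: "G (Inl (y, x)) = h y / 2" for y
    using sq[of "b x y / 2"] b_nonneg[of x y]
    by (cases "y = x") (auto simp: G_def e_def h_def b_sym[of y x] algebra_simps)
  have G3: "G (Inr (Inl x)) = of_real (c x) * w x" "G (Inr (Inr x)) = of_real (m x) * w x"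
    using sq[OF c_nonneg[of x]] sq[OF less_imp_le[OF m_pos[of x]]]
    by (simp_all add: G_def e_def mult_ac)
  \<comment> \<open>\<open>T e\<close> vanishes off these three sets. The loop at \<open>x\<close>
    is kept only in \<open>?A\<close> to make the sets disjoint; its term is 0. The two orientations
    give half of the edge sum each.\<close>
  let ?A = "(\<lambda>y. Inl (x, y)) ` UNIV :: (('v \<times> 'v) + ('v + 'v)) set"
  let ?B = "(\<lambda>y. Inl (y, x)) ` (UNIV - {x}) :: (('v \<times> 'v) + ('v + 'v)) set"
  let ?C = "{Inr (Inl x), Inr (Inr x)} :: (('v \<times> 'v) + ('v + 'v)) set"
  \<comment> \<open>Convergence of the series in \<open>Ltilde\<close> is inherited from the inner
    product, whose terms over \<open>?A\<close> are the halves of \<open>h\<close>.\<close>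
  have "G summable_on ?A"
    by (rule summable_on_subset_banach[OF has_sum_imp_summable[OF G0]]) simp
  then have "(\<lambda>y. h y / 2) summable_on UNIV"
    by (subst (asm) summable_on_reindex) (auto simp: inj_on_def o_def G1)
  from summable_on_cmult_right[OF this, of 2] have "h summable_on UNIV" by simp
  then have hH: "(h has_sum (\<Sum>\<^sub>\<infinity>y. h y)) UNIV" by simp
  define H where "H = (\<Sum>\<^sub>\<infinity>y. h y)"
  have hs: "((\<lambda>y. h y / 2) has_sum (H / 2)) UNIV"
    using has_sum_cmult_right[OF hH, of "1/2"] by (simp add: H_def)
  have "((\<lambda>y. h y / 2) has_sum (H / 2)) (UNIV - {x})"
    by (rule has_sum_cong_neutral[THEN iffD1, OF _ _ _ hs]) (auto simp: h_def b_diag)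
  then have B: "(G has_sum (H / 2)) ?B"
    by (subst has_sum_reindex) (auto simp: inj_on_def o_def G2)
  have A: "(G has_sum (H / 2)) ?A"
    using hs by (subst has_sum_reindex) (auto simp: inj_on_def o_def G1)
  have C: "(G has_sum (of_real (c x) * w x + of_real (m x) * w x)) ?C"
    by (rule has_sum_finiteI) (auto simp: G3)
  have "(G has_sum (H / 2 + H / 2 + (of_real (c x) * w x + of_real (m x) * w x))) (?A \<union> ?B \<union> ?C)"
    by (intro has_sum_Un_disjoint A B C) auto
  moreover have "(G has_sum s) (?A \<union> ?B \<union> ?C) \<longleftrightarrow> (G has_sum s) UNIV" for s
  proof (rule has_sum_cong_neutral)
    show "G i = 0" if "i \<in> UNIV - (?A \<union> ?B \<union> ?C)" for i
      using that by (cases i rule: energy_index_cases) (auto simp: G_def e_def)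
  qed auto
  ultimately have "H / 2 + H / 2 + (of_real (c x) * w x + of_real (m x) * w x) = 0"
    using has_sum_unique[OF _ G0] by blast
  then have eq: "H + of_real (c x) * w x + of_real (m x) * w x = 0"
    by (simp add: field_simps)
  have "Ltilde m b c w x + w x = (H + of_real (c x) * w x + of_real (m x) * w x) / of_real (m x)"
    using m_pos[of x] by (simp add: Ltilde_def H_def h_def[abs_def] field_simps)
  then show ?thesis by (simp add: eq)
qed

end

section \<open>Boundary values on the completion\<close>

locale completed_graph = weighted_graph m b c
  for m :: "'v \<Rightarrow> real" and b c +
  fixes \<iota> :: "'v \<Rightarrow> 'x::metric_space" and X :: "'x set"
  assumes conn: "graph_connected b"
    and compl: "is_completion (path_metric b) \<iota> X"
begin

lemma range_subset: "range \<iota> \<subseteq> X" and subset_closure: "X \<subseteq> closure (range \<iota>)"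
  and dist_\<iota>: "dist (\<iota> x) (\<iota> y) = path_metric b x y"
  using compl by (auto simp: is_completion_def)

text \<open>Connectedness makes the set of path lengths nonempty, so its infimum is a greatest lower
  bound.\<close>

lemma path_metric_greatest:
  assumes "\<And>xs. is_path b xs x y \<Longrightarrow> r \<le> path_length b xs"
  shows "r \<le> path_metric b x y"
  unfolding path_metric_def
  by (rule cInf_greatest) (use assms conn in \<open>auto simp: graph_connected_def\<close>)

lemma lipschitz:
  assumes "u \<in> D"
  shows "cmod (u x - u y) \<le> N u * dist (\<iota> x) (\<iota> y)"
\<comment> \<open>Dividing by \<open>N u\<close> moves the path bound under the infimum. When
  \<open>N u = 0\<close>, a single path already forces \<open>u x = u y\<close>.\<close>
proof (cases "N u = 0")
  case True
  obtain xs where "is_path b xs x y" using conn by (auto simp: graph_connected_def)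
  from path_bound[OF assms this] True show ?thesis by simp
next
  case False
  then have pos: "N u > 0" using N_nonneg[OF assms] by simp
  have "cmod (u x - u y) / N u \<le> path_metric b x y"
    by (rule path_metric_greatest) (use path_bound[OF assms] pos in \<open>simp add: field_simps\<close>)
  then show ?thesis using pos by (simp add: dist_\<iota> field_simps)
qed

text \<open>The radius comes from the weighted degree and is uniform over all other vertices; for a
  lone vertex any radius works. This also shows that \<open>path_metric b\<close> separates points,
  hence that \<iota> is injective.\<close>

lemma vertex_isolated: "\<exists>r>0. \<forall>y. y \<noteq> x \<longrightarrow> r \<le> dist (\<iota> x) (\<iota> y)"
proof (cases "\<exists>y. y \<noteq> x")
  case True
  then obtain y xs where "y \<noteq> x" "is_path b xs x y"
    using conn unfolding graph_connected_def by blast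
  then have "1 / sqrt (\<Sum>\<^sub>\<infinity>z. b x z) > 0"
    using path_length_ge_degree(2)[of xs x y] by simp
  moreover have "1 / sqrt (\<Sum>\<^sub>\<infinity>z. b x z) \<le> dist (\<iota> x) (\<iota> y)" if "y \<noteq> x" for y
    unfolding dist_\<iota> by (rule path_metric_greatest) (use path_length_ge_degree(1) that in metis)
  ultimately show ?thesis by blast
qed (auto intro: exI[of _ 1])

lemma inj_\<iota>: "inj \<iota>"
proof (rule injI, rule ccontr)
  fix x y assume "\<iota> x = \<iota> y" "x \<noteq> y"
  then show False using vertex_isolated[of x] by (metis dist_self not_le)
qed

lemma inv_\<iota> [simp]: "inv \<iota> (\<iota> x) = x"
  by (rule inv_f_f[OF inj_\<iota>])

lemma vertex_not_islimpt: "\<not> \<iota> x islimpt range \<iota>"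
proof
  assume "\<iota> x islimpt range \<iota>"
  moreover obtain r where "r > 0" "\<And>y. y \<noteq> x \<Longrightarrow> r \<le> dist (\<iota> x) (\<iota> y)"
    using vertex_isolated by blast
  ultimately show False
    unfolding islimpt_approachable by (metis dist_commute imageE not_le)
qed

text \<open>A boundary point lies in the closure of the vertices without being one, so it is a limit
  point. This makes the limit in \<open>ext_val\<close> unique.\<close>

lemma boundary_nontrivial:
  assumes "z \<in> X - range \<iota>"
  shows "at z within range \<iota> \<noteq> bot"
  using assms subset_closure by (auto simp: trivial_limit_within closure_def)

text \<open>Guarantees that the \<open>Lim\<close> in \<open>ext_val\<close> is a genuine limit: a
  Lipschitz function on the vertices is uniformly continuous and extends to the closure.\<close>

lemma tendsto_ext_val:
  assumes u: "u \<in> D" and z: "z \<in> X - range \<iota>"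
  shows "((\<lambda>p. u (inv \<iota> p)) \<longlongrightarrow> ext_val \<iota> u z) (at z within range \<iota>)"
proof -
  have "uniformly_continuous_on (range \<iota>) (\<lambda>p. u (inv \<iota> p))"
    unfolding uniformly_continuous_on_def
  proof (intro allI impI)
    fix e :: real assume e: "e > 0"
    \<comment> \<open>The constant is enlarged by 1 so that it can be divided by even if
      \<open>N u\<close> is 0.\<close>
    have N: "N u + 1 > 0" using N_nonneg[OF u] by simp
    have "dist (u x) (u y) < e" if "dist (\<iota> x) (\<iota> y) < e / (N u + 1)" for x y
    proof -
      have "dist (u x) (u y) \<le> N u * dist (\<iota> x) (\<iota> y)"
        using lipschitz[OF u] by (simp add: dist_norm)
      also have "\<dots> \<le> (N u + 1) * dist (\<iota> x) (\<iota> y)"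
        by (intro mult_right_mono) auto
      also have "\<dots> < e" using that N by (simp add: field_simps)
      finally show ?thesis .
    qed
    then show "\<exists>d>0. \<forall>p\<in>range \<iota>. \<forall>q\<in>range \<iota>. dist q p < d \<longrightarrow> dist (u (inv \<iota> q)) (u (inv \<iota> p)) < e"
      using e N by (intro exI[of _ "e / (N u + 1)"]) auto
  qed
  then obtain l where l: "((\<lambda>p. u (inv \<iota> p)) \<longlongrightarrow> l) (at z within range \<iota>)"
    using uniformly_continuous_on_extension_at_closure z subset_closure by blast
  moreover have "ext_val \<iota> u z = l"
    unfolding ext_val_def by (rule tendsto_Lim[OF boundary_nontrivial[OF z] l])
  ultimately show ?thesis by simp
qed

section \<open>Linearity, kernel and continuity of the boundary map\<close>

lemma ext_val_linear:
  assumes "u \<in> D" "v \<in> D" "z \<in> X - range \<iota>"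
  shows "ext_val \<iota> (\<lambda>x. \<alpha> * u x + \<beta> * v x) z = \<alpha> * ext_val \<iota> u z + \<beta> * ext_val \<iota> v z"
  unfolding ext_val_def[of _ "\<lambda>x. \<alpha> * u x + \<beta> * v x"]
  by (intro tendsto_Lim boundary_nontrivial tendsto_intros tendsto_ext_val assms)

lemma ext_val_diff:
  assumes "u \<in> D" "v \<in> D" "z \<in> X - range \<iota>"
  shows "ext_val \<iota> (\<lambda>x. u x - v x) z = ext_val \<iota> u z - ext_val \<iota> v z"
  using ext_val_linear[OF assms, of 1 "-1"] by simp

lemma ext_val_finite_support:
  assumes "finite {x. \<phi> x \<noteq> 0}" "z \<in> X - range \<iota>"
  shows "ext_val \<iota> \<phi> z = 0"
  unfolding ext_val_def
proof (rule tendsto_Lim[OF boundary_nontrivial[OF assms(2)]], rule tendsto_eventually)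
  \<comment> \<open>Membership in the range is recorded because \<open>inv \<iota>\<close> recovers
    the vertex only there.\<close>
  have "\<forall>\<^sub>F p in at z within range \<iota>. p \<notin> \<iota> ` {x. \<phi> x \<noteq> 0} \<and> p \<in> range \<iota>"
    by (intro eventually_conj eventually_at_notin_finite finite_imageI assms(1))
      (simp add: eventually_at_filter)
  then show "\<forall>\<^sub>F p in at z within range \<iota>. \<phi> (inv \<iota> p) = 0"
    by eventually_elim auto
qed

text \<open>The vertex \<open>x\<close> serves as an anchor: the value there is controlled by the
  mass term and the increment from there by the Lipschitz bound. The constant depends on
  \<open>z\<close> only through the distance to \<open>x\<close>, so it is bounded on balls.\<close>

lemma ext_val_bound:
  assumes u: "u \<in> D" and z: "z \<in> X - range \<iota>"
  shows "cmod (ext_val \<iota> u z) \<le> (1 / sqrt (m x) + dist (\<iota> x) z) * N u"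
proof (rule tendsto_le[OF boundary_nontrivial[OF z]])
  show "((\<lambda>p. cmod (u (inv \<iota> p))) \<longlongrightarrow> cmod (ext_val \<iota> u z)) (at z within range \<iota>)"
    by (intro tendsto_norm tendsto_ext_val assms)
  show "((\<lambda>p. (1 / sqrt (m x) + dist (\<iota> x) p) * N u) \<longlongrightarrow> (1 / sqrt (m x) + dist (\<iota> x) z) * N u)
      (at z within range \<iota>)"
    by (intro tendsto_intros)
  have "cmod (u y) \<le> (1 / sqrt (m x) + dist (\<iota> x) (\<iota> y)) * N u" for y
  proof -
    have "cmod (u y) \<le> cmod (u x) + cmod (u x - u y)"
      using norm_triangle_ineq[of "u x" "u y - u x"] by (simp add: norm_minus_commute)
    also have "\<dots> \<le> N u / sqrt (m x) + N u * dist (\<iota> x) (\<iota> y)"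
      by (intro add_mono point_bound lipschitz u)
    finally show ?thesis by (simp add: field_simps)
  qed
  then show "\<forall>\<^sub>F p in at z within range \<iota>. cmod (u (inv \<iota> p)) \<le> (1 / sqrt (m x) + dist (\<iota> x) p) * N u"
    unfolding eventually_at_filter by (intro always_eventually) auto
qed

lemma DQD_subset: "DQD m b c \<subseteq> D"
  by (auto simp: DQD_def)

lemma ext_val_DQD:
  assumes u: "u \<in> DQD m b c" and z: "z \<in> X - range \<iota>"
  shows "ext_val \<iota> u z = 0"
proof -
  have uD: "u \<in> D" using u DQD_subset by blast
  obtain \<phi> where \<phi>: "\<And>n. finite {x. \<phi> n x \<noteq> (0::complex)}" "\<And>n. \<phi> n \<in> D"
    and lim: "(\<lambda>n. N (\<lambda>x. u x - \<phi> n x)) \<longlonglongrightarrow> 0"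
    using u by (auto simp: DQD_def)
  \<comment> \<open>\<open>undefined\<close> stands for an arbitrary anchor vertex.\<close>
  define K where "K = 1 / sqrt (m undefined) + dist (\<iota> undefined) z"
  have "cmod (ext_val \<iota> u z) \<le> K * N (\<lambda>x. u x - \<phi> n x)" for n
    using ext_val_bound[OF D_diff(1)[OF uD \<phi>(2)] z, of n undefined]
    by (simp add: ext_val_diff[OF uD \<phi>(2) z] ext_val_finite_support[OF \<phi>(1) z] K_def)
  moreover have "(\<lambda>n. K * N (\<lambda>x. u x - \<phi> n x)) \<longlonglongrightarrow> K * 0"
    by (intro tendsto_intros lim)
  ultimately have "cmod (ext_val \<iota> u z) \<le> K * 0"
    by (intro tendsto_lowerbound[where F = sequentially]) auto
  then show ?thesis by simp
qed

lemma zero_in_DQD: "(\<lambda>x. 0) \<in> DQD m b c"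
proof -
  have "(\<lambda>x. 0) \<in> D"
    using D_diff(1)[OF indicator_in_D indicator_in_D, of undefined undefined] by simp
  then show ?thesis
    unfolding DQD_def by (auto intro!: exI[of _ "\<lambda>n x. 0"])
qed

text \<open>Subtracting an element of \<open>DQD\<close> leaves the boundary value unchanged, so
  \<open>ext_val_bound\<close> holds for every representative and passes to the infimum, taken over
  a set that is nonempty by \<open>zero_in_DQD\<close>.\<close>

lemma ext_val_quot_bound:
  assumes u: "u \<in> D" and z: "z \<in> X - range \<iota>"
  shows "cmod (ext_val \<iota> u z) \<le> (1 / sqrt (m x) + dist (\<iota> x) z) * quot_norm m b c u"
proof -
  define K where "K = 1 / sqrt (m x) + dist (\<iota> x) z"
  have K: "K > 0" unfolding K_def using m_pos[of x] by (intro add_pos_nonneg) auto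
  have "cmod (ext_val \<iota> u z) / K \<le> quot_norm m b c u"
    unfolding quot_norm_def
  proof (rule cInf_greatest)
    fix r assume "r \<in> {N (\<lambda>x. u x - \<phi> x) | \<phi>. \<phi> \<in> DQD m b c}"
    then obtain \<phi> where \<phi>: "\<phi> \<in> DQD m b c" "r = N (\<lambda>x. u x - \<phi> x)" by blast
    then have \<phi>D: "\<phi> \<in> D" using DQD_subset by blast
    have "cmod (ext_val \<iota> u z) \<le> K * r"
      using ext_val_bound[OF D_diff(1)[OF u \<phi>D] z, of x]
      by (simp add: ext_val_diff[OF u \<phi>D z] ext_val_DQD[OF \<phi>(1) z] K_def \<phi>(2))
    then show "cmod (ext_val \<iota> u z) / K \<le> r" using K by (simp add: field_simps)
  qed (use zero_in_DQD in blast)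
  then have "cmod (ext_val \<iota> u z) \<le> K * quot_norm m b c u"
    using K by (simp add: field_simps)
  then show ?thesis unfolding K_def .
qed

lemma ext_val_locally_uniform:
  assumes u: "u \<in> D" and us: "\<And>n. us n \<in> D"
    and lim: "(\<lambda>n. quot_norm m b c (\<lambda>x. us n x - u x)) \<longlonglongrightarrow> 0"
  shows "uniform_limit (ball z 1 \<inter> (X - range \<iota>)) (\<lambda>n. ext_val \<iota> (us n)) (ext_val \<iota> u) sequentially"
proof (rule uniform_limitI)
  fix e :: real assume e: "e > 0"
  \<comment> \<open>The added 1 is the radius of the ball: by the triangle inequality
    \<open>K\<close> dominates the anchor constant of every point in it.\<close>
  define K where "K = 1 / sqrt (m undefined) + (dist (\<iota> undefined) z + 1)"
  have K: "K > 0" unfolding K_def using m_pos[of undefined] by (intro add_pos_nonneg) auto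
  define q where "q n = quot_norm m b c (\<lambda>x. us n x - u x)" for n
  have "\<forall>\<^sub>F n in sequentially. q n < e / K"
    using lim e K unfolding q_def by (intro order_tendstoD(2)) auto
  then show "\<forall>\<^sub>F n in sequentially. \<forall>y\<in>ball z 1 \<inter> (X - range \<iota>).
      dist (ext_val \<iota> (us n) y) (ext_val \<iota> u y) < e"
  proof eventually_elim
    case (elim n)
    show ?case
    proof
      fix y assume y: "y \<in> ball z 1 \<inter> (X - range \<iota>)"
      let ?k = "1 / sqrt (m undefined) + dist (\<iota> undefined) y"
      have k: "?k > 0" using m_pos[of undefined] by (intro add_pos_nonneg) auto
      have "?k \<le> K"
        using y dist_triangle[of "\<iota> undefined" y z] by (simp add: K_def)
      have le: "dist (ext_val \<iota> (us n) y) (ext_val \<iota> u y) \<le> ?k * q n"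
        using ext_val_quot_bound[OF D_diff(1)[OF us u], of y n undefined] y
        by (simp add: ext_val_diff[OF us u] dist_norm q_def)
      \<comment> \<open>A distance is at most a positive multiple of \<open>q n\<close>, which
        forces its sign.\<close>
      then have "0 \<le> q n"
        using k by (smt (verit) zero_le_dist zero_le_mult_iff)
      then have "?k * q n \<le> K * q n"
        by (intro mult_right_mono \<open>?k \<le> K\<close>)
      also have "\<dots> < e" using elim K by (simp add: field_simps)
      finally show "dist (ext_val \<iota> (us n) y) (ext_val \<iota> u y) < e" using le by simp
    qed
  qed
qed

section \<open>Injectivity for compact completions\<close>

lemma finite_superlevel_set:
  assumes "compact X" and h: "h \<in> D" and zero: "\<And>z. z \<in> X - range \<iota> \<Longrightarrow> ext_val \<iota> h z = 0"
    and e: "e > 0"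
  shows "finite {x. e \<le> cmod (h x)}"
proof (rule ccontr)
  define A where "A = \<iota> ` {x. e \<le> cmod (h x)}"
  assume "infinite {x. e \<le> cmod (h x)}"
  then have "infinite A"
    unfolding A_def using inj_\<iota> by (simp add: finite_image_iff inj_on_subset)
  moreover have "A \<subseteq> X" using range_subset by (auto simp: A_def)
  \<comment> \<open>An infinite superlevel set would accumulate at some \<open>z\<close>. Vertices
    are isolated, so \<open>z\<close> is a boundary point, and along \<open>A\<close> the function
    \<open>h\<close> would tend to 0 while its modulus stays above \<open>e\<close>.\<close>
  ultimately obtain z where z: "z \<in> X" "z islimpt A"
    using \<open>compact X\<close> unfolding compact_eq_Bolzano_Weierstrass by blast
  then have "z islimpt range \<iota>" by (rule_tac islimpt_subset) (auto simp: A_def)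
  then have zb: "z \<in> X - range \<iota>" using z vertex_not_islimpt by auto
  have "((\<lambda>p. h (inv \<iota> p)) \<longlongrightarrow> 0) (at z within A)"
    using tendsto_ext_val[OF h zb] unfolding zero[OF zb]
    by (rule tendsto_within_subset) (auto simp: A_def)
  then have "((\<lambda>p. cmod (h (inv \<iota> p))) \<longlongrightarrow> 0) (at z within A)"
    by (rule tendsto_norm_zero)
  moreover have "\<forall>\<^sub>F p in at z within A. e \<le> cmod (h (inv \<iota> p))"
    unfolding eventually_at_filter A_def by (intro always_eventually) auto
  moreover have "at z within A \<noteq> bot"
    using z(2) by (simp add: trivial_limit_within)
  ultimately have "e \<le> 0" by (rule tendsto_lowerbound)
  with e show False by simp
qed

text \<open>If \<open>P\<close> is the projection of the complex plane onto a small disc around \<open>0\<close>, then \<open>h - P \<circ> h\<close> vanishes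
  where \<open>\<bar>h\<bar>\<close> is small; as \<open>P\<close> is a contraction fixing \<open>0\<close>, the energy density of \<open>P \<circ> h\<close> is dominated
  by that of \<open>h\<close>.\<close>

lemma vanishing_boundary_in_DQD:
  assumes "compact X" and h: "h \<in> D" and zero: "\<And>z. z \<in> X - range \<iota> \<Longrightarrow> ext_val \<iota> h z = 0"
  shows "h \<in> DQD m b c"
proof -
  define \<epsilon> where "\<epsilon> n = 1 / real (Suc n)" for n
  define P where "P n = closest_point (cball (0::complex) (\<epsilon> n))" for n
  define \<phi> where "\<phi> n x = h x - P n (h x)" for n x
  have \<epsilon>: "\<epsilon> n > 0" for n by (simp add: \<epsilon>_def)
  have \<epsilon>_lim: "\<epsilon> \<longlonglongrightarrow> 0"
    using LIMSEQ_inverse_real_of_nat by (simp add: \<epsilon>_def[abs_def] inverse_eq_divide)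
  have P_lip: "cmod (P n s - P n t) \<le> cmod (s - t)" for n s t
    unfolding P_def dist_norm[symmetric]
    by (rule closest_point_lipschitz) (use \<epsilon>[of n] in auto)
  have P_self: "P n s = s" if "cmod s \<le> \<epsilon> n" for n s
    unfolding P_def by (rule closest_point_self) (use that in simp)
  have P_le: "cmod (P n s) \<le> cmod s" for n s
    using P_lip[of n s 0] P_self[of 0 n] \<epsilon>[of n] by simp
  have "P n s \<in> cball 0 (\<epsilon> n)" for n s
    unfolding P_def by (rule closest_point_in_set) (use \<epsilon>[of n] in auto)
  then have P_small: "cmod (P n s) \<le> \<epsilon> n" for n s by simp
  have P_lim: "(\<lambda>n. P n s) \<longlonglongrightarrow> 0" for s
    by (rule Lim_null_comparison[OF _ \<epsilon>_lim]) (simp add: P_small)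
  \<comment> \<open>Edge terms use that \<open>P n\<close> is a contraction, vertex terms that it
    does not increase the modulus.\<close>
  have dom: "cmod (T (\<lambda>x. P n (h x)) i) \<le> cmod (T h i)" for n i
    by (cases i rule: energy_index_cases)
      (auto simp: norm_mult b_nonneg c_nonneg less_imp_le[OF m_pos] intro!: mult_left_mono P_lip P_le)
  have lim: "(\<lambda>n. T (\<lambda>x. P n (h x)) i) \<longlonglongrightarrow> 0" for i
    by (cases i rule: energy_index_cases)
      (auto intro!: tendsto_mult_right_zero P_lim tendsto_diff[OF P_lim P_lim, simplified])
  have sq: "sq_summable (T h)" using h by (simp add: mem_D_iff)
  have PD: "(\<lambda>x. P n (h x)) \<in> D" for n
    unfolding mem_D_iff by (rule sq_summable_dominated[OF sq dom])
  have "{x. \<phi> n x \<noteq> 0} \<subseteq> {x. \<epsilon> n \<le> cmod (h x)}" for n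
  proof
    fix x assume "x \<in> {x. \<phi> n x \<noteq> 0}"
    then show "x \<in> {x. \<epsilon> n \<le> cmod (h x)}"
      using P_self[of "h x" n] by (cases "cmod (h x) \<le> \<epsilon> n") (auto simp: \<phi>_def)
  qed
  then have "finite {x. \<phi> n x \<noteq> 0}" for n
    using finite_superlevel_set[OF assms(1) h zero \<epsilon>] by (rule finite_subset)
  moreover have "\<phi> n \<in> D" for n
    unfolding \<phi>_def by (rule D_diff(1)[OF h PD])
  \<comment> \<open>The error \<open>h - \<phi> n\<close> is the projected function, whose energy
    vector is dominated by \<open>T h\<close> and tends to 0 at each index.\<close>
  moreover have "(\<lambda>n. N (\<lambda>x. h x - \<phi> n x)) \<longlonglongrightarrow> 0"
    using l2norm_dominated_convergence[OF sq dom lim] by (simp add: \<phi>_def N_eq_l2norm[OF PD])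
  ultimately show ?thesis
    using h unfolding DQD_def by blast
qed

end

section \<open>Assembly of the six claims\<close>

theorem mainTheorem11:
  fixes m :: "'v::countable \<Rightarrow> real" and b :: "'v \<Rightarrow> 'v \<Rightarrow> real" and c :: "'v \<Rightarrow> real"
    and \<iota> :: "'v \<Rightarrow> 'x::metric_space" and X :: "'x set"
  assumes graph: "graph_over m b c"
    and conn: "graph_connected b"
    and compl: "is_completion (path_metric b) \<iota> X"
  defines "Vinf \<equiv> X - range \<iota>"
  shows
    "(\<forall>u \<in> DQD m b c. \<forall>z \<in> Vinf. ext_val \<iota> u z = 0)
     \<and> (\<forall>u \<in> DQN m b c. \<forall>v \<in> DQN m b c. \<forall>\<alpha> \<beta>. \<forall>z \<in> Vinf.
          ext_val \<iota> (\<lambda>x. \<alpha> * u x + \<beta> * v x) z = \<alpha> * ext_val \<iota> u z + \<beta> * ext_val \<iota> v z)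
     \<and> (\<forall>u \<in> DQN m b c. \<forall>us. (\<forall>n. us n \<in> DQN m b c) \<longrightarrow>
          (\<lambda>n. quot_norm m b c (\<lambda>x. us n x - u x)) \<longlonglongrightarrow> 0 \<longrightarrow>
          (\<forall>z \<in> Vinf. \<exists>U. open U \<and> z \<in> U \<and>
             uniform_limit (U \<inter> Vinf) (\<lambda>n. ext_val \<iota> (us n)) (ext_val \<iota> u) sequentially))
     \<and> (\<forall>g \<in> {(\<lambda>z \<in> Vinf. ext_val \<iota> u z) | u. u \<in> DQN m b c}.
          \<exists>u \<in> DQN m b c. (\<lambda>z \<in> Vinf. ext_val \<iota> u z) = g)
     \<and> (\<forall>f \<in> DQN m b c. \<exists>w \<in> DQN m b c.
          (\<forall>x. Ltilde m b c w x + w x = 0) \<and> (\<forall>z \<in> Vinf. ext_val \<iota> w z = ext_val \<iota> f z))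
     \<and> (compact X \<longrightarrow> (\<forall>u \<in> DQN m b c. \<forall>v \<in> DQN m b c.
          (\<forall>z \<in> Vinf. ext_val \<iota> u z = ext_val \<iota> v z) \<longrightarrow> (\<lambda>x. u x - v x) \<in> DQD m b c))"
proof -
  interpret completed_graph m b c \<iota> X
    using graph conn compl by unfold_locales
  have eq5: "\<exists>w \<in> D. (\<forall>x. Ltilde m b c w x + w x = 0) \<and> (\<forall>z \<in> Vinf. ext_val \<iota> w z = ext_val \<iota> f z)"
    if f: "f \<in> D" for f
  proof -
    obtain w where w: "w \<in> D" and fw: "(\<lambda>x. f x - w x) \<in> DQD m b c"
      and min: "\<And>\<psi>. finite {x. \<psi> x \<noteq> 0} \<Longrightarrow> \<psi> \<in> D \<Longrightarrow> N w \<le> N (\<lambda>x. w x + \<psi> x)"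
      using DQD_projection[OF f] by blast
    \<comment> \<open>The difference of \<open>f\<close> and \<open>w\<close> lies in
      \<open>DQD\<close>, where boundary values vanish.\<close>
    have "ext_val \<iota> w z = ext_val \<iota> f z" if "z \<in> Vinf" for z
      using ext_val_DQD[OF fw] ext_val_diff[OF f w] that by (simp add: Vinf_def)
    with w Ltilde_minimizer[OF w min] show ?thesis by blast
  qed
  have eq6: "(\<lambda>x. u x - v x) \<in> DQD m b c"
    if "compact X" "u \<in> D" "v \<in> D" "\<forall>z \<in> Vinf. ext_val \<iota> u z = ext_val \<iota> v z" for u v
    using that by (intro vanishing_boundary_in_DQD D_diff(1)) (auto simp: ext_val_diff Vinf_def)
  have eq3: "\<exists>U. open U \<and> z \<in> U \<and>
      uniform_limit (U \<inter> Vinf) (\<lambda>n. ext_val \<iota> (us n)) (ext_val \<iota> u) sequentially"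
    if "u \<in> D" "\<forall>n. us n \<in> D" "(\<lambda>n. quot_norm m b c (\<lambda>x. us n x - u x)) \<longlonglongrightarrow> 0" for u us z
    unfolding Vinf_def
    by (rule exI[of _ "ball z 1"]) (use that ext_val_locally_uniform in simp)
  show ?thesis
  proof (intro conjI)
    show "\<forall>u \<in> DQD m b c. \<forall>z \<in> Vinf. ext_val \<iota> u z = 0"
      unfolding Vinf_def using ext_val_DQD by blast
    show "\<forall>u \<in> D. \<forall>v \<in> D. \<forall>\<alpha> \<beta>. \<forall>z \<in> Vinf.
        ext_val \<iota> (\<lambda>x. \<alpha> * u x + \<beta> * v x) z = \<alpha> * ext_val \<iota> u z + \<beta> * ext_val \<iota> v z"
      unfolding Vinf_def using ext_val_linear by blast
    \<comment> \<open>The target is by definition the set of all boundary functions, so surjectivity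
      is immediate; the solution \<open>w\<close> of the next claim is the substantial part.\<close>
    show "\<forall>g \<in> {(\<lambda>z \<in> Vinf. ext_val \<iota> u z) | u. u \<in> D}. \<exists>u \<in> D. (\<lambda>z \<in> Vinf. ext_val \<iota> u z) = g"
      by blast
  qed (use eq3 eq5 eq6 in blast)+
qed

end
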